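(* Let $(Y_t)_{t\in\mathbb Z}$ and $(X_t)_{t\in\mathbb Z}$ be stationary real-valued time series with $Y_t=\Phi(Y_{t-1},\epsilon_t)$ and $X_t=\Psi(Y_t,\epsilon_{t+1},\dots,\epsilon_{t+s})$, $t\in\mathbb Z$, in the setting described in the context. Assume that there are $\alpha>0$, $p\in[0,1]$ and $C\in(0,\infty)$ such that $$\lim_{x\to\infty}\frac{P(|Y_0|>ux)}{P(|Y_0|>x)}=u^{-\alpha}\ \ \forall u>0,\qquad \lim_{x\to\infty}\frac{P(Y_0>x)}{P(|Y_0|>x)}=p,\qquad \lim_{x\to\infty}\frac{P(|X_0|>x)}{P(|Y_0|>x)}=C.$$ Then for all integers $-\infty<m\le n<\infty$ the family of conditional distributions $$\mathcal L\left(\frac{Y_m}{x},\dots,\frac{Y_n}{x}\;\middle|\;|X_0|>x\right),\qquad x>1,$$ is tight.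
   Context: Setting: $s\ge 1$ is an integer, $(\mathbb S,\mathcal S)$ is a measurable space, $(\epsilon_t)_{t\in\mathbb Z}$ is an i.i.d. sequence of $\mathbb S$-valued random variables, $\Phi:\mathbb R\times\mathbb S\to\mathbb R$ and $\Psi:\mathbb R\times\mathbb S^{s}\to\mathbb R$ are measurable, and for every $r\in\mathbb Z$ the innovations $(\epsilon_t)_{t>r}$ are independent of $(Y_t)_{t\le r}$. $\mathcal L(\cdot\mid\cdot)$ denotes a conditional distribution given an event. *)

theory Defs
  imports "HOL-Probability.Probability"
begin

text \<open>Strict stationarity of a real-valued time series, i.e. shift invariance of the law of the
  whole process on the product space indexed by the integers.\<close>

definition stationary_series :: "'w measure \<Rightarrow> (int \<Rightarrow> 'w \<Rightarrow> real) \<Rightarrow> bool" where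
  "stationary_series M Y \<longleftrightarrow>
     (\<forall>t. Y t \<in> borel_measurable M) \<and>
     (\<forall>h. distr M (PiM UNIV (\<lambda>_. borel)) (\<lambda>\<omega> t. Y (t + h) \<omega>) =
          distr M (PiM UNIV (\<lambda>_. borel)) (\<lambda>\<omega> t. Y t \<omega>))"

text \<open>Measurability of the variables is part of \<^const>\<open>prob_space.indep_vars\<close>.\<close>

definition iid_sequence :: "'w measure \<Rightarrow> 's measure \<Rightarrow> (int \<Rightarrow> 'w \<Rightarrow> 's) \<Rightarrow> bool" where
  "iid_sequence M S \<epsilon> \<longleftrightarrow>
     prob_space.indep_vars M (\<lambda>_. S) \<epsilon> UNIV \<and>
     (\<forall>t t'. distr M S (\<epsilon> t) = distr M S (\<epsilon> t'))"

text \<open>Independence of two random variables with values in possibly different types, via the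
  independence of the generated sigma-algebras; \<^const>\<open>prob_space.indep_var\<close> forces both
  ranges to have the same type.\<close>

definition indep_rvs ::
    "'w measure \<Rightarrow> 'a measure \<Rightarrow> ('w \<Rightarrow> 'a) \<Rightarrow> 'b measure \<Rightarrow> ('w \<Rightarrow> 'b) \<Rightarrow> bool" where
  "indep_rvs M N Z N' Z' \<longleftrightarrow>
     Z \<in> measurable M N \<and> Z' \<in> measurable M N' \<and>
     prob_space.indep_set M
       (sets (vimage_algebra (space M) Z N)) (sets (vimage_algebra (space M) Z' N'))"

text \<open>The conditional law of a random variable given an event. It is the usual object only for
  events of positive probability; for null events \<^const>\<open>uniform_measure\<close> is the zero measure,
  which \<open>tight_family\<close> below rejects.\<close>

definition cond_law :: "'w measure \<Rightarrow> 'b measure \<Rightarrow> ('w \<Rightarrow> 'b) \<Rightarrow> 'w set \<Rightarrow> 'b measure" where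
  "cond_law M N Z A = distr (uniform_measure M A) N Z"

text \<open>Tightness of an arbitrary family of probability measures; the library notion
  \<^const>\<open>tight\<close> only covers sequences of measures on the real line. Measurability of
  the compact set is required because \<^const>\<open>measure\<close> vanishes on non-measurable sets.\<close>

definition tight_family :: "'b topology \<Rightarrow> 'i set \<Rightarrow> ('i \<Rightarrow> 'b measure) \<Rightarrow> bool" where
  "tight_family T I \<mu> \<longleftrightarrow>
     (\<forall>i\<in>I. prob_space (\<mu> i) \<and> space (\<mu> i) = topspace T) \<and>
     (\<forall>e>0. \<exists>K. compactin T K \<and>
        (\<forall>i\<in>I. K \<in> sets (\<mu> i) \<and> measure (\<mu> i) (topspace T - K) \<le> e))"

end

theory Submission
  imports Defs
begin

text \<open>Since \<open>P(|Y\<^sub>t| > K x, |X\<^sub>0| > x) / P(|X\<^sub>0| > x)\<close> is at most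
  \<open>P(|Y\<^sub>0| > K x) / P(|X\<^sub>0| > x)\<close>, which tends to \<open>K powr (- \<alpha>) / C\<close>, a large \<open>K\<close>
  makes it small for all \<open>x \<ge> x\<^sub>0\<close>. For \<open>1 < x < x\<^sub>0\<close> it is bounded by
  \<open>P(|Y\<^sub>0| > K) / P(|X\<^sub>0| > x\<^sub>0)\<close>. Stationarity and a union bound over
  the coordinates do the rest.\<close>

text \<open>A positive limit makes the quotient positive at points beyond any given
  \<open>x\<close>, and antimonotonicity carries positivity of \<open>g\<close> back to
  \<open>x\<close>. Applied to the tail of \<open>\<bar>X 0\<bar>\<close>, this shows that no
  conditioning event is null, even for small thresholds.\<close>

lemma antimono_pos_of_ratio_tendsto_pos:
  fixes f g :: "real \<Rightarrow> real"
  assumes "antimono g" and "\<And>x. 0 \<le> f x"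
    and "((\<lambda>x. g x / f x) \<longlongrightarrow> C) at_top" and "0 < C"
  shows "0 < g x"
proof -
  have "eventually (\<lambda>z. 0 < g z / f z \<and> x \<le> z) at_top"
    by (intro eventually_conj order_tendstoD(1)[OF assms(3,4)] eventually_ge_at_top)
  then obtain z where "0 < g z / f z" "x \<le> z"
    using eventually_happens'[OF trivial_limit_at_top_linorder] by blast
  then show ?thesis
    using assms(2)[of z] antimonoD[OF assms(1) \<open>x \<le> z\<close>] by (auto simp: zero_less_divide_iff)
qed

text \<open>Here \<open>f\<close> and \<open>g\<close> stand for the tails of
  \<open>\<bar>Y 0\<bar>\<close> and \<open>\<bar>X 0\<bar>\<close>. One \<open>K\<close> must serve
  every \<open>x > 1\<close>, whereas the limits speak only about large \<open>x\<close>.\<close>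

lemma regularly_varying_uniform_tail_bound:
  fixes f g :: "real \<Rightarrow> real"
  assumes f: "antimono f" "\<And>x. 0 \<le> f x" "(f \<longlongrightarrow> 0) at_top"
    and g: "antimono g"
    and \<alpha>: "0 < \<alpha>" and C: "0 < C"
    and rv: "\<And>u. 0 < u \<Longrightarrow> ((\<lambda>x. f (u * x) / f x) \<longlongrightarrow> u powr (- \<alpha>)) at_top"
    and gf: "((\<lambda>x. g x / f x) \<longlongrightarrow> C) at_top"
    and e: "0 < e"
  obtains K where "0 < K" "\<And>x. 1 < x \<Longrightarrow> f (K * x) \<le> e * g x"
proof -
  have gpos: "0 < g x" for x
    by (rule antimono_pos_of_ratio_tendsto_pos[OF g f(2) gf C])
  have "((\<lambda>u::real. u powr (- \<alpha>)) \<longlongrightarrow> 0) at_top"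
    using \<alpha> by (intro tendsto_neg_powr filterlim_ident) auto
  then have "eventually (\<lambda>u. u powr (- \<alpha>) < e * C) at_top"
    by (rule order_tendstoD(2)) (use e C in simp)
  then have "eventually (\<lambda>u. 1 \<le> u \<and> u powr (- \<alpha>) < e * C) at_top"
    by (intro eventually_conj eventually_ge_at_top)
  \<comment> \<open>The threshold \<open>e * C\<close> is chosen because
    \<open>f (K1 * x) / g x\<close> will tend to \<open>K1 powr (- \<alpha>) / C\<close>, which must
    lie below \<open>e\<close>.\<close>
  then obtain K1 :: real where K1: "1 \<le> K1" "K1 powr (- \<alpha>) < e * C"
    using eventually_happens'[OF trivial_limit_at_top_linorder] by blast
  have "((\<lambda>x. (f (K1 * x) / f x) / (g x / f x)) \<longlongrightarrow> K1 powr (- \<alpha>) / C) at_top"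
    using rv[of K1] K1 C by (intro tendsto_divide gf) auto
  then have "eventually (\<lambda>x. (f (K1 * x) / f x) / (g x / f x) < e) at_top"
    by (rule order_tendstoD(2)) (use K1 C in \<open>simp add: divide_less_eq\<close>)
  moreover have "eventually (\<lambda>x. 0 < g x / f x) at_top"
    by (rule order_tendstoD(1)[OF gf C])
  ultimately have "eventually (\<lambda>x. f (K1 * x) \<le> e * g x) at_top"
  proof eventually_elim
    case (elim x)
    \<comment> \<open>Division by zero yields 0, so positivity of \<open>g x / f x\<close> excludes
      \<open>f x = 0\<close>; only then does \<open>f x\<close> cancel from the quotient of
      quotients.\<close>
    then have "f x \<noteq> 0" by auto
    with elim(1) have "f (K1 * x) / g x < e" by simp
    then show ?case using gpos[of x] by (simp add: divide_less_eq)
  qed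
  then obtain x0 where x0: "\<And>x. x0 \<le> x \<Longrightarrow> f (K1 * x) \<le> e * g x"
    by (auto simp: eventually_at_top_linorder)
  \<comment> \<open>The constant \<open>K2\<close> serves the range \<open>1 < x < x0\<close>, where
    \<open>g x0\<close> is a positive lower bound for \<open>g x\<close>.\<close>
  have "eventually (\<lambda>z. f z < e * g x0) at_top"
    by (rule order_tendstoD(2)[OF f(3)]) (use e gpos in simp)
  then obtain K2 where K2: "f K2 < e * g x0"
    by (auto simp: eventually_at_top_linorder)
  define K where "K = max K1 K2"
  have "0 < K" using K1 by (auto simp: K_def)
  moreover have "f (K * x) \<le> e * g x" if x: "1 < x" for x
  proof (cases "x0 \<le> x")
    case True
    have "f (K * x) \<le> f (K1 * x)"
      using x by (intro antimonoD[OF f(1)] mult_right_mono) (auto simp: K_def)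
    then show ?thesis using x0[OF True] by simp
  next
    case False
    \<comment> \<open>The restriction \<open>1 < x\<close> enters here: it keeps
      \<open>K * x\<close> above \<open>K2\<close>.\<close>
    have "K2 \<le> K * 1" by (simp add: K_def)
    also have "\<dots> \<le> K * x" using x \<open>0 < K\<close> by (intro mult_left_mono) auto
    finally have "f (K * x) \<le> f K2" by (rule antimonoD[OF f(1)])
    also have "\<dots> \<le> e * g x0" using K2 by simp
    also have "\<dots> \<le> e * g x"
      using False e by (intro mult_left_mono antimonoD[OF g]) auto
    finally show ?thesis .
  qed
  ultimately show thesis by (rule that)
qed

lemma (in prob_space) antimono_tail_prob:
  fixes Z :: "'a \<Rightarrow> real"
  assumes [measurable]: "Z \<in> borel_measurable M"
  shows "antimono (\<lambda>x. \<P>(\<omega> in M. x < Z \<omega>))"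
  by (intro antimonoI finite_measure_mono) auto

lemma (in prob_space) tail_prob_tendsto_0:
  fixes Z :: "'a \<Rightarrow> real"
  assumes [measurable]: "Z \<in> borel_measurable M"
  shows "((\<lambda>x. \<P>(\<omega> in M. x < Z \<omega>)) \<longlongrightarrow> 0) at_top"
proof -
  interpret D: real_distribution "distr M borel Z"
    by (rule real_distribution_distr) simp
  have "\<P>(\<omega> in M. x < Z \<omega>) = 1 - cdf (distr M borel Z) x" for x
  proof -
    have "cdf (distr M borel Z) x = \<P>(\<omega> in M. Z \<omega> \<le> x)"
      unfolding cdf_def by (subst measure_distr) (auto intro!: arg_cong[where f = prob])
    moreover have "\<P>(\<omega> in M. \<not> Z \<omega> \<le> x) = 1 - \<P>(\<omega> in M. Z \<omega> \<le> x)"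
      by (rule prob_neg) measurable
    ultimately show ?thesis by (simp add: not_le)
  qed
  moreover have "((\<lambda>x. 1 - cdf (distr M borel Z) x) \<longlongrightarrow> 1 - 1) at_top"
    by (intro tendsto_intros D.cdf_lim_at_top_prob)
  ultimately show ?thesis by simp
qed

text \<open>Stationarity concerns the law of the whole process; evaluating it on a cylinder over
  coordinate 0 gives the equality of marginals. The time enters only through the shift.\<close>

lemma stationary_series_prob_eq:
  assumes "stationary_series M Y" and [measurable]: "Measurable.pred borel Q"
  shows "\<P>(\<omega> in M. Q (Y t \<omega>)) = \<P>(\<omega> in M. Q (Y 0 \<omega>))"
proof -
  have [measurable]: "Y t \<in> borel_measurable M" for t
    using assms(1) by (simp add: stationary_series_def)
  let ?P = "PiM UNIV (\<lambda>_::int. borel :: real measure)"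
  let ?A = "{f \<in> space ?P. Q (f 0)}"
  have law: "\<P>(\<omega> in M. Q (Y h \<omega>)) = measure (distr M ?P (\<lambda>\<omega> r. Y (r + h) \<omega>)) ?A" for h
  proof -
    have "(\<lambda>\<omega> r. Y (r + h) \<omega>) \<in> measurable M ?P"
      by (rule measurable_PiM_single') auto
    moreover have "?A \<in> sets ?P" by measurable
    moreover have "(\<lambda>\<omega> r. Y (r + h) \<omega>) -` ?A \<inter> space M = {\<omega> \<in> space M. Q (Y h \<omega>)}"
      by (auto simp: space_PiM)
    ultimately show ?thesis by (simp only: measure_distr)
  qed
  have shift: "distr M ?P (\<lambda>\<omega> r. Y (r + h) \<omega>) = distr M ?P (\<lambda>\<omega> r. Y r \<omega>)" for h
    using assms(1) unfolding stationary_series_def by blast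
  show ?thesis
    \<comment> \<open>The right-hand side also carries a shift, namely \<open>r + 0\<close>, so both
      process laws are rewritten to the unshifted one.\<close>
    unfolding law[of t] law[of 0] shift[of t] shift[of 0] ..
qed

lemma prob_space_cond_law:
  assumes "prob_space M" and "Z \<in> measurable M N" and "measure M A \<noteq> 0"
  shows "prob_space (cond_law M N Z A)"
proof -
  interpret prob_space M by fact
  \<comment> \<open>Since \<open>enn2real\<close> sends both 0 and infinity to 0, a nonzero
    \<open>measure M A\<close> rules out both degenerate values of
    \<open>emeasure M A\<close>.\<close>
  have "prob_space (uniform_measure M A)"
    using assms(3) by (intro prob_space_uniform_measure) (auto simp: measure_def)
  moreover have "Z \<in> measurable (uniform_measure M A) N"
    using assms(2) by simp
  ultimately show ?thesis
    unfolding cond_law_def by (rule prob_space.prob_space_distr)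
qed

lemma measure_cond_law:
  assumes "prob_space M" and "Z \<in> measurable M N"
    and "A \<in> sets M" and "measure M A \<noteq> 0" and "B \<in> sets N"
  shows "measure (cond_law M N Z A) B = measure M (A \<inter> Z -` B) / measure M A"
proof -
  interpret prob_space M by fact
  have "measure (cond_law M N Z A) B = measure (uniform_measure M A) (Z -` B \<inter> space M)"
    unfolding cond_law_def using assms by (subst measure_distr) auto
  also have "\<dots> = measure M (A \<inter> (Z -` B \<inter> space M)) / measure M A"
    using assms by (intro measure_uniform_measure)
      (auto simp: emeasure_eq_measure measurable_sets)
  also have "A \<inter> (Z -` B \<inter> space M) = A \<inter> Z -` B"
    using sets.sets_into_space[OF assms(3)] by auto
  finally show ?thesis .
qed

theorem proposition2p1:
  fixes M :: "'w measure" and S :: "'s measure"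
    and \<epsilon> :: "int \<Rightarrow> 'w \<Rightarrow> 's"
    and X Y :: "int \<Rightarrow> 'w \<Rightarrow> real"
    and s :: nat
    and \<Phi> :: "real \<times> 's \<Rightarrow> real"
    and \<Psi> :: "real \<times> (nat \<Rightarrow> 's) \<Rightarrow> real"
    and \<alpha> p C :: real
    and m n :: int
  assumes "prob_space M"
    and "s \<ge> 1"
    and "iid_sequence M S \<epsilon>"
    and "\<Phi> \<in> borel_measurable (borel \<Otimes>\<^sub>M S)"
    and "\<Psi> \<in> borel_measurable (borel \<Otimes>\<^sub>M PiM {1..s} (\<lambda>_. S))"
    and "\<And>r. indep_rvs M
               (PiM {r<..} (\<lambda>_. S)) (\<lambda>\<omega>. \<lambda>t\<in>{r<..}. \<epsilon> t \<omega>)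
               (PiM {..r} (\<lambda>_. borel)) (\<lambda>\<omega>. \<lambda>t\<in>{..r}. Y t \<omega>)"
    and "stationary_series M Y"
    and "stationary_series M X"
    and "\<And>t. AE \<omega> in M. Y t \<omega> = \<Phi> (Y (t - 1) \<omega>, \<epsilon> t \<omega>)"
    and "\<And>t. AE \<omega> in M. X t \<omega> = \<Psi> (Y t \<omega>, \<lambda>i\<in>{1..s}. \<epsilon> (t + int i) \<omega>)"
    and "\<alpha> > 0"
    and "p \<in> {0..1}"
    and "C > 0"
    and "\<And>u. u > 0 \<Longrightarrow>
           ((\<lambda>x. \<P>(\<omega> in M. \<bar>Y 0 \<omega>\<bar> > u * x) / \<P>(\<omega> in M. \<bar>Y 0 \<omega>\<bar> > x)) \<longlongrightarrow> u powr (- \<alpha>)) at_top"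
    and "((\<lambda>x. \<P>(\<omega> in M. Y 0 \<omega> > x) / \<P>(\<omega> in M. \<bar>Y 0 \<omega>\<bar> > x)) \<longlongrightarrow> p) at_top"
    and "((\<lambda>x. \<P>(\<omega> in M. \<bar>X 0 \<omega>\<bar> > x) / \<P>(\<omega> in M. \<bar>Y 0 \<omega>\<bar> > x)) \<longlongrightarrow> C) at_top"
    and "m \<le> n"
  shows "tight_family (product_topology (\<lambda>_. euclideanreal) {m..n}) {1<..}
           (\<lambda>x::real. cond_law M (PiM {m..n} (\<lambda>_. borel))
                        (\<lambda>\<omega>. \<lambda>t\<in>{m..n}. Y t \<omega> / x)
                        {\<omega> \<in> space M. \<bar>X 0 \<omega>\<bar> > x})"
proof -
  interpret prob_space M by fact
  have [measurable]: "Y t \<in> borel_measurable M" "X t \<in> borel_measurable M" for t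
    using assms(7,8) by (auto simp: stationary_series_def)
  define f where "f = (\<lambda>x. \<P>(\<omega> in M. x < \<bar>Y 0 \<omega>\<bar>))"
  define g where "g = (\<lambda>x. \<P>(\<omega> in M. x < \<bar>X 0 \<omega>\<bar>))"
  have f: "antimono f" "\<And>x. 0 \<le> f x" "(f \<longlongrightarrow> 0) at_top"
    unfolding f_def by (auto intro!: antimono_tail_prob tail_prob_tendsto_0)
  have g: "antimono g"
    unfolding g_def by (auto intro!: antimono_tail_prob)
  have rv: "((\<lambda>x. f (u * x) / f x) \<longlongrightarrow> u powr (- \<alpha>)) at_top" if "0 < u" for u
    using assms(14)[OF that] by (simp add: f_def)
  have gf: "((\<lambda>x. g x / f x) \<longlongrightarrow> C) at_top"
    using assms(16) by (simp add: f_def g_def)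
  have gpos: "0 < g x" for x
    by (rule antimono_pos_of_ratio_tendsto_pos[OF g f(2) gf \<open>C > 0\<close>])
  have Ytail: "\<P>(\<omega> in M. y < \<bar>Y t \<omega>\<bar>) = f y" for t y
    unfolding f_def by (rule stationary_series_prob_eq[OF assms(7)]) measurable
  let ?N = "PiM {m..n} (\<lambda>_. borel :: real measure)"
  let ?T = "product_topology (\<lambda>_. euclideanreal) {m..n}"
  let ?A = "\<lambda>x. {\<omega> \<in> space M. \<bar>X 0 \<omega>\<bar> > x}"
  let ?Z = "\<lambda>x \<omega>. \<lambda>t\<in>{m..n}. Y t \<omega> / x"
  have Z: "?Z x \<in> measurable M ?N" for x
    by measurable
  have sp: "space ?N = topspace ?T"
    by (simp add: space_PiM)
  have law: "prob_space (cond_law M ?N (?Z x) (?A x))"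
    "space (cond_law M ?N (?Z x) (?A x)) = topspace ?T" for x
  proof -
    have "prob (?A x) \<noteq> 0" using gpos[of x] by (simp add: g_def)
    then show "prob_space (cond_law M ?N (?Z x) (?A x))"
      by (rule prob_space_cond_law[OF prob_space_axioms Z])
    show "space (cond_law M ?N (?Z x) (?A x)) = topspace ?T"
      by (simp only: cond_law_def space_distr sp)
  qed
  have "\<exists>K. compactin ?T K \<and> (\<forall>x\<in>{1<..}. K \<in> sets (cond_law M ?N (?Z x) (?A x)) \<and>
      measure (cond_law M ?N (?Z x) (?A x)) (topspace ?T - K) \<le> e)" if e: "0 < e" for e
  proof -
    define d where "d = real (card {m..n})"
    have d: "0 < d" using \<open>m \<le> n\<close> by (simp add: d_def)
    \<comment> \<open>The union bound below adds one term per coordinate, so each of the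
      \<open>d\<close> coordinates is allotted \<open>e / d\<close>.\<close>
    obtain K where K: "0 < K" "\<And>x. 1 < x \<Longrightarrow> f (K * x) \<le> e / d * g x"
      using regularly_varying_uniform_tail_bound
        [OF f g \<open>\<alpha> > 0\<close> \<open>C > 0\<close> rv gf divide_pos_pos[OF e d]] by blast
    \<comment> \<open>The compact set is a box: a product of compact intervals is compact by
      Tychonoff, and a finite product of Borel sets is measurable. Its extensional functions match
      the \<open>restrict\<close> in \<open>?Z\<close>.\<close>
    let ?B = "PiE {m..n} (\<lambda>_. {-K..K})"
    have B: "?B \<in> sets ?N"
      by (intro sets_PiM_I_finite) auto
    have "measure (cond_law M ?N (?Z x) (?A x)) (topspace ?T - ?B) \<le> e" if x: "1 < x" for x
    proof -
      have out: "\<exists>t\<in>{m..n}. K * x < \<bar>Y t \<omega>\<bar>" if "?Z x \<omega> \<notin> ?B" for \<omega>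
      proof (rule ccontr)
        assume "\<not> ?thesis"
        then have "\<bar>Y t \<omega> / x\<bar> \<le> K" if "t \<in> {m..n}" for t
          using that x by (auto simp: not_less divide_le_eq abs_divide)
        then have "Y t \<omega> / x \<in> {-K..K}" if "t \<in> {m..n}" for t
          using that unfolding atLeastAtMost_iff abs_le_iff minus_le_iff[of _ K] by blast
        then have "?Z x \<omega> \<in> ?B"
          by (simp only: restrict_PiE_iff) blast
        with \<open>?Z x \<omega> \<notin> ?B\<close> show False by contradiction
      qed
      \<comment> \<open>The condition \<open>\<bar>X 0 \<omega>\<bar> > x\<close> is dropped from
        the numerator. This is affordable because \<open>f\<close> and \<open>g\<close> have the
        same order of decay, so a large \<open>K\<close> still beats the division by
        \<open>g x\<close>.\<close>
      have "prob (?A x \<inter> ?Z x -` (topspace ?T - ?B))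
          \<le> prob (\<Union>t\<in>{m..n}. {\<omega> \<in> space M. K * x < \<bar>Y t \<omega>\<bar>})"
      proof (rule finite_measure_mono)
        show "?A x \<inter> ?Z x -` (topspace ?T - ?B)
            \<subseteq> (\<Union>t\<in>{m..n}. {\<omega> \<in> space M. K * x < \<bar>Y t \<omega>\<bar>})"
          using out by blast
      qed measurable
      also have "\<dots> \<le> (\<Sum>t\<in>{m..n}. \<P>(\<omega> in M. K * x < \<bar>Y t \<omega>\<bar>))"
        by (intro finite_measure_subadditive_finite) auto
      \<comment> \<open>By stationarity all coordinates share the tail \<open>f\<close>, so the sum
        is a multiple of a single term.\<close>
      also have "\<dots> = d * f (K * x)"
        by (simp add: Ytail d_def)
      also have "\<dots> \<le> d * (e / d * g x)"
        using K(2)[OF x] d by (intro mult_left_mono) auto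
      also have "\<dots> = e * g x" using d by simp
      finally have "prob (?A x \<inter> ?Z x -` (topspace ?T - ?B)) / g x \<le> e"
        using gpos[of x] by (simp add: divide_le_eq)
      moreover have "measure (cond_law M ?N (?Z x) (?A x)) (topspace ?T - ?B)
          = prob (?A x \<inter> ?Z x -` (topspace ?T - ?B)) / prob (?A x)"
      proof (rule measure_cond_law[OF prob_space_axioms Z])
        show "topspace ?T - ?B \<in> sets ?N"
          using sets.compl_sets[OF B] by (simp only: sp)
        show "prob (?A x) \<noteq> 0" using gpos[of x] by (simp add: g_def)
      qed measurable
      ultimately show ?thesis by (simp add: g_def)
    qed
    moreover have "compactin ?T ?B"
      by (simp add: compactin_PiE)
    ultimately show ?thesis using B by (auto simp: cond_law_def intro!: exI[of _ ?B])
  qed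
  with law show ?thesis unfolding tight_family_def by blast
qed

end
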